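(* For any non-negative integers $n$ and $m$ there is a homeomorphism $$|\Delta_n\times\Delta_m|\cong|\Delta_n|\times|\Delta_m|.$$
   Context: For $n\ge 0$, $[n]=\{0<1<\cdots<n\}$, and $\Delta$ is the category with objects $[n]$, $n\ge0$, and order preserving (weakly monotone) maps as morphisms. Simplicial sets are contravariant functors $\Delta\to\mathtt{Set}$; the product of simplicial sets is $(C\times D)([n])=C([n])\times D([n])$. $\Delta_n$ is the simplicial set represented by $[n]$. The topological standard $n$-simplex is $|\Delta_n|=\{(x_0,\ldots,x_n)\in\mathbb{R}^{n+1}: x_i\ge 0,\ \sum x_i=1\}$ with the subspace topology; $\theta:[n]\to[m]$ induces $\theta_*:|\Delta_n|\to|\Delta_m|$, $\theta_*(t_0,\ldots,t_n)=(s_0,\ldots,s_m)$ with $s_i=\sum_{j\in\theta^{-1}(i)}t_j$. The geometric realization of a simplicial set $C$ is the colimit in topological spaces $|C|=\varinjlim_{\Delta_n\to C}|\Delta_n|$ over the category $\Delta\downarrow C$ whose objects are maps of simplicial sets $\Delta_n\to C$ and whose morphisms are commuting triangles over $C$. The product on the right carries the product topology. *)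

theory Defs
  imports "HOL-Analysis.Analysis" "HOL-Homology.Simplices"
begin

section \<open>Simplicial sets\<close>

text \<open>
  The object \<open>[n]\<close> of \<open>\<Delta>\<close> is the set \<open>{..n}\<close> of natural numbers. Morphisms are extensional
  functions, so that equality of morphisms is equality in the logic; they are composed with
  \<open>compose\<close>, where \<open>compose {..n} \<phi> \<theta>\<close> is \<open>\<phi>\<close> after \<open>\<theta>\<close>, restricted to \<open>{..n}\<close>.
\<close>

definition Delta_hom :: "nat \<Rightarrow> nat \<Rightarrow> (nat \<Rightarrow> nat) set" where
  "Delta_hom n m = {\<theta> \<in> {..n} \<rightarrow>\<^sub>E {..m}. mono_on {..n} \<theta>}"

text \<open>
  In \<open>pullback X n m \<theta>\<close> the map \<open>\<theta>\<close> goes from \<open>[n]\<close> to \<open>[m]\<close>, so the induced function goes from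
  the \<open>m\<close>-simplices to the \<open>n\<close>-simplices.
\<close>

record 'a sset =
  simplices :: "nat \<Rightarrow> 'a set"
  pullback :: "nat \<Rightarrow> nat \<Rightarrow> (nat \<Rightarrow> nat) \<Rightarrow> 'a \<Rightarrow> 'a"

locale simplicial_set =
  fixes X :: "'a sset"
  assumes pullback_closed:
      "\<lbrakk>\<theta> \<in> Delta_hom n m; x \<in> simplices X m\<rbrakk> \<Longrightarrow> pullback X n m \<theta> x \<in> simplices X n"
    and pullback_id:
      "x \<in> simplices X n \<Longrightarrow> pullback X n n (\<lambda>i\<in>{..n}. i) x = x"
    and pullback_compose:
      "\<lbrakk>\<theta> \<in> Delta_hom n m; \<phi> \<in> Delta_hom m k; x \<in> simplices X k\<rbrakk> \<Longrightarrow>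
         pullback X n k (compose {..n} \<phi> \<theta>) x = pullback X n m \<theta> (pullback X m k \<phi> x)"

text \<open>Maps of simplicial sets, as families of functions extensional at every level.\<close>

definition sset_hom :: "'a sset \<Rightarrow> 'b sset \<Rightarrow> (nat \<Rightarrow> 'a \<Rightarrow> 'b) set" where
  "sset_hom X Y =
     {f. (\<forall>k. f k \<in> simplices X k \<rightarrow>\<^sub>E simplices Y k) \<and>
         (\<forall>k l. \<forall>\<theta> \<in> Delta_hom k l. \<forall>x \<in> simplices X l.
            f k (pullback X k l \<theta> x) = pullback Y k l \<theta> (f l x))}"

definition sset_compose ::
  "'a sset \<Rightarrow> (nat \<Rightarrow> 'b \<Rightarrow> 'c) \<Rightarrow> (nat \<Rightarrow> 'a \<Rightarrow> 'b) \<Rightarrow> nat \<Rightarrow> 'a \<Rightarrow> 'c" where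
  "sset_compose X g f = (\<lambda>k. compose (simplices X k) (g k) (f k))"

definition sset_prod :: "'a sset \<Rightarrow> 'b sset \<Rightarrow> ('a \<times> 'b) sset" where
  "sset_prod X Y =
     \<lparr>simplices = (\<lambda>k. simplices X k \<times> simplices Y k),
      pullback = (\<lambda>k l \<theta>. map_prod (pullback X k l \<theta>) (pullback Y k l \<theta>))\<rparr>"

definition Delta_sset :: "nat \<Rightarrow> (nat \<Rightarrow> nat) sset" where
  "Delta_sset n =
     \<lparr>simplices = (\<lambda>k. Delta_hom k n),
      pullback = (\<lambda>k l \<theta> \<sigma>. compose {..k} \<sigma> \<theta>)\<rparr>"

definition Delta_sset_map :: "nat \<Rightarrow> (nat \<Rightarrow> nat) \<Rightarrow> nat \<Rightarrow> (nat \<Rightarrow> nat) \<Rightarrow> (nat \<Rightarrow> nat)" where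
  "Delta_sset_map n \<theta> = (\<lambda>k. \<lambda>\<sigma> \<in> Delta_hom k n. compose {..k} \<theta> \<sigma>)"

lemma Delta_hom_id: "(\<lambda>i\<in>{..n}. i) \<in> Delta_hom n n"
  by (auto simp: Delta_hom_def mono_on_def)

lemma Delta_hom_compose:
  assumes "\<theta> \<in> Delta_hom n m" "\<phi> \<in> Delta_hom m k"
  shows "compose {..n} \<phi> \<theta> \<in> Delta_hom n k"
  using assms unfolding Delta_hom_def mono_on_def compose_def PiE_def Pi_def by auto

lemma simplicial_set_Delta_sset: "simplicial_set (Delta_sset n)"
proof
  fix \<theta> a b x assume "\<theta> \<in> Delta_hom a b" "x \<in> simplices (Delta_sset n) b"
  then show "pullback (Delta_sset n) a b \<theta> x \<in> simplices (Delta_sset n) a"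
    by (simp add: Delta_sset_def Delta_hom_compose)
next
  fix x a assume "x \<in> simplices (Delta_sset n) a"
  then show "pullback (Delta_sset n) a a (\<lambda>i\<in>{..a}. i) x = x"
    by (auto simp: Delta_sset_def Delta_hom_def compose_def fun_eq_iff PiE_def extensional_def)
next
  fix \<theta> a b \<phi> c x
  assume "\<theta> \<in> Delta_hom a b" "\<phi> \<in> Delta_hom b c" "x \<in> simplices (Delta_sset n) c"
  then show "pullback (Delta_sset n) a c (compose {..a} \<phi> \<theta>) x =
    pullback (Delta_sset n) a b \<theta> (pullback (Delta_sset n) b c \<phi> x)"
    by (auto simp: Delta_sset_def Delta_hom_def compose_def fun_eq_iff)
qed

lemma simplicial_set_sset_prod:
  assumes "simplicial_set X" "simplicial_set Y"
  shows "simplicial_set (sset_prod X Y)"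
proof -
  interpret X: simplicial_set X by fact
  interpret Y: simplicial_set Y by fact
  show ?thesis
    by unfold_locales
      (auto simp: sset_prod_def X.pullback_closed Y.pullback_closed X.pullback_id Y.pullback_id
         X.pullback_compose Y.pullback_compose)
qed

lemma Delta_sset_map_in_sset_hom:
  assumes "\<theta> \<in> Delta_hom n m"
  shows "Delta_sset_map n \<theta> \<in> sset_hom (Delta_sset n) (Delta_sset m)"
  using assms
  by (auto simp: sset_hom_def Delta_sset_def Delta_sset_map_def Delta_hom_compose)
    (auto simp: compose_def fun_eq_iff Delta_hom_def)


section \<open>Colimits of topological spaces\<close>

definition quotient_topology :: "'a topology \<Rightarrow> ('a \<times> 'a) set \<Rightarrow> 'a set topology" where
  "quotient_topology X R = topology (\<lambda>U. U \<subseteq> topspace X // R \<and> openin X (\<Union>U))"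

lemma openin_quotient_topology:
  assumes "equiv (topspace X) R"
  shows "openin (quotient_topology X R) U \<longleftrightarrow> U \<subseteq> topspace X // R \<and> openin X (\<Union>U)"
proof -
  have "\<Union>(S \<inter> T) = \<Union>S \<inter> \<Union>T" if "S \<subseteq> topspace X // R" "T \<subseteq> topspace X // R" for S T
  proof
    show "\<Union>S \<inter> \<Union>T \<subseteq> \<Union>(S \<inter> T)"
    proof
      fix x assume "x \<in> \<Union>S \<inter> \<Union>T"
      then obtain s t where "x \<in> s" "s \<in> S" "x \<in> t" "t \<in> T" by blast
      moreover from this that have "s = t"
        using quotient_disj[OF assms] by blast
      ultimately show "x \<in> \<Union>(S \<inter> T)" by blast
    qed
  qed blast
  moreover have "\<Union>(\<Union>\<K>) = \<Union>(Union ` \<K>)" for \<K> :: "'a set set set"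
    by blast
  ultimately have "istopology (\<lambda>U. U \<subseteq> topspace X // R \<and> openin X (\<Union>U))"
    unfolding istopology_def by (auto intro: openin_Union simp: openin_Int)
  then show ?thesis
    by (simp add: quotient_topology_def)
qed

lemma quotient_map_quotient_topology:
  assumes "equiv (topspace X) R"
  shows "quotient_map X (quotient_topology X R) (\<lambda>x. R `` {x})"
proof -
  have eq: "{x \<in> topspace X. R `` {x} \<in> U} = \<Union>U" if "U \<subseteq> topspace X // R" for U
  proof (intro equalityI subsetI)
    fix x assume "x \<in> {x \<in> topspace X. R `` {x} \<in> U}"
    then show "x \<in> \<Union>U"
      using equiv_class_self[OF assms] by blast
  next
    fix x assume "x \<in> \<Union>U"
    then obtain u where u: "x \<in> u" "u \<in> U" by blast
    with that obtain y where "y \<in> topspace X" "u = R `` {y}"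
      by (auto elim: quotientE)
    with u have "(y, x) \<in> R" by blast
    then have "R `` {x} = u" "x \<in> topspace X"
      using assms \<open>u = R `` {y}\<close> by (auto dest: equiv_class_eq[OF assms] equiv_class_eq_iff[OF assms, THEN iffD1])
    with u show "x \<in> {x \<in> topspace X. R `` {x} \<in> U}" by blast
  qed
  have "openin X (\<Union>(topspace X // R))"
    by (simp add: Union_quotient[OF assms])
  then have top: "topspace (quotient_topology X R) = topspace X // R"
    unfolding topspace_def openin_quotient_topology[OF assms] by blast
  show ?thesis
    unfolding quotient_map_def top
    by (auto simp: eq openin_quotient_topology[OF assms] quotient_def)
qed

text \<open>
  The colimit in topological spaces of a diagram with objects \<open>I\<close>, spaces \<open>F i\<close>, arrows
  \<open>A i j\<close> from \<open>i\<close> to \<open>j\<close>, and maps \<open>G i j a\<close> from \<open>F i\<close> to \<open>F j\<close>: the disjoint union of the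
  spaces modulo the equivalence relation generated by \<open>(i, x) \<sim> (j, G i j a x)\<close>.
\<close>

definition colim_step ::
  "'i set \<Rightarrow> ('i \<Rightarrow> 'x topology) \<Rightarrow> ('i \<Rightarrow> 'i \<Rightarrow> 'a set) \<Rightarrow> ('i \<Rightarrow> 'i \<Rightarrow> 'a \<Rightarrow> 'x \<Rightarrow> 'x) \<Rightarrow>
     'i \<times> 'x \<Rightarrow> 'i \<times> 'x \<Rightarrow> bool" where
  "colim_step I F A G p q \<longleftrightarrow>
     (\<exists>i\<in>I. \<exists>j\<in>I. \<exists>a\<in>A i j. \<exists>x\<in>topspace (F i). p = (i, x) \<and> q = (j, G i j a x))"

definition colim_rel ::
  "'i set \<Rightarrow> ('i \<Rightarrow> 'x topology) \<Rightarrow> ('i \<Rightarrow> 'i \<Rightarrow> 'a set) \<Rightarrow> ('i \<Rightarrow> 'i \<Rightarrow> 'a \<Rightarrow> 'x \<Rightarrow> 'x) \<Rightarrow>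
     (('i \<times> 'x) \<times> ('i \<times> 'x)) set" where
  "colim_rel I F A G =
     {(p, q). p \<in> topspace (sum_topology F I) \<and> q \<in> topspace (sum_topology F I) \<and>
              equivclp (colim_step I F A G) p q}"

definition colim_topology ::
  "'i set \<Rightarrow> ('i \<Rightarrow> 'x topology) \<Rightarrow> ('i \<Rightarrow> 'i \<Rightarrow> 'a set) \<Rightarrow> ('i \<Rightarrow> 'i \<Rightarrow> 'a \<Rightarrow> 'x \<Rightarrow> 'x) \<Rightarrow>
     ('i \<times> 'x) set topology" where
  "colim_topology I F A G = quotient_topology (sum_topology F I) (colim_rel I F A G)"

lemma equiv_colim_rel: "equiv (topspace (sum_topology F I)) (colim_rel I F A G)"
  unfolding equiv_def refl_on_def sym_def trans_def colim_rel_def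
  by (auto intro: equivclp_sym equivclp_trans)

text \<open>The universal property of \<open>colim_topology\<close>: the canonical cocone, and its initiality.\<close>

definition colim_in ::
  "'i set \<Rightarrow> ('i \<Rightarrow> 'x topology) \<Rightarrow> ('i \<Rightarrow> 'i \<Rightarrow> 'a set) \<Rightarrow> ('i \<Rightarrow> 'i \<Rightarrow> 'a \<Rightarrow> 'x \<Rightarrow> 'x) \<Rightarrow>
     'i \<Rightarrow> 'x \<Rightarrow> ('i \<times> 'x) set" where
  "colim_in I F A G i x = colim_rel I F A G `` {(i, x)}"

lemma quotient_map_colim:
  "quotient_map (sum_topology F I) (colim_topology I F A G) (\<lambda>(i, x). colim_in I F A G i x)"
  using quotient_map_quotient_topology[OF equiv_colim_rel]
  by (simp add: colim_topology_def colim_in_def case_prod_unfold)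

lemma continuous_map_colim_in:
  assumes "i \<in> I"
  shows "continuous_map (F i) (colim_topology I F A G) (colim_in I F A G i)"
  using continuous_map_compose[OF continuous_map_component_injection[OF assms]
      quotient_imp_continuous_map[OF quotient_map_colim]]
  by (simp add: o_def)

lemma colim_in_commutes:
  assumes "i \<in> I" "j \<in> I" "a \<in> A i j" "x \<in> topspace (F i)" "G i j a x \<in> topspace (F j)"
  shows "colim_in I F A G j (G i j a x) = colim_in I F A G i x"
proof -
  have "equivclp (colim_step I F A G) (i, x) (j, G i j a x)"
    using assms by (intro r_into_equivclp) (auto simp: colim_step_def)
  then have "((i, x), (j, G i j a x)) \<in> colim_rel I F A G"
    using assms by (simp add: colim_rel_def)
  then show ?thesis
    unfolding colim_in_def using equiv_class_eq[OF equiv_colim_rel] by metis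
qed

lemma colim_universal:
  assumes h: "\<And>i. i \<in> I \<Longrightarrow> continuous_map (F i) Y (h i)"
    and comm: "\<And>i j a x. \<lbrakk>i \<in> I; j \<in> I; a \<in> A i j; x \<in> topspace (F i)\<rbrakk> \<Longrightarrow> h j (G i j a x) = h i x"
  shows "\<exists>u. continuous_map (colim_topology I F A G) Y u \<and>
           (\<forall>i\<in>I. \<forall>x\<in>topspace (F i). u (colim_in I F A G i x) = h i x)"
    and "\<lbrakk>\<forall>i\<in>I. \<forall>x\<in>topspace (F i). u (colim_in I F A G i x) = h i x;
          \<forall>i\<in>I. \<forall>x\<in>topspace (F i). v (colim_in I F A G i x) = h i x;
          c \<in> topspace (colim_topology I F A G)\<rbrakk> \<Longrightarrow> u c = v c"
proof -
  have eq: "case_prod h p = case_prod h q" if "equivclp (colim_step I F A G) p q" for p q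
    using that by induction (use comm in \<open>force simp: colim_step_def\<close>)+
  define u where "u c = case_prod h (SOME p. p \<in> c)" for c
  have u: "u (colim_in I F A G i x) = h i x" if "i \<in> I" "x \<in> topspace (F i)" for i x
  proof -
    have "(i, x) \<in> colim_in I F A G i x"
      using that by (simp add: colim_in_def colim_rel_def)
    then have "(SOME p. p \<in> colim_in I F A G i x) \<in> colim_in I F A G i x"
      by (rule someI)
    then have "equivclp (colim_step I F A G) (i, x) (SOME p. p \<in> colim_in I F A G i x)"
      unfolding colim_in_def[of I F A G i x] colim_rel_def by blast
    from eq[OF this] show ?thesis
      by (simp add: u_def)
  qed
  have "continuous_map (sum_topology F I) Y (u \<circ> (\<lambda>(i, x). colim_in I F A G i x))"
    using h by (auto simp: continuous_map_def u openin_sum_topology Pi_iff cong: conj_cong)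
  then have "continuous_map (colim_topology I F A G) Y u"
    by (rule continuous_compose_quotient_map[OF quotient_map_colim])
  with u show "\<exists>u. continuous_map (colim_topology I F A G) Y u \<and>
      (\<forall>i\<in>I. \<forall>x\<in>topspace (F i). u (colim_in I F A G i x) = h i x)"
    by blast
next
  assume uv: "\<forall>i\<in>I. \<forall>x\<in>topspace (F i). u (colim_in I F A G i x) = h i x"
      "\<forall>i\<in>I. \<forall>x\<in>topspace (F i). v (colim_in I F A G i x) = h i x"
    and "c \<in> topspace (colim_topology I F A G)"
  then have "c \<in> (\<lambda>(i, x). colim_in I F A G i x) ` Sigma I (topspace \<circ> F)"
    using quotient_imp_surjective_map[OF quotient_map_colim] by (metis topspace_sum_topology)
  then obtain i x where "i \<in> I" "x \<in> topspace (F i)" "c = colim_in I F A G i x"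
    by auto
  with uv show "u c = v c" by simp
qed


section \<open>Geometric realization\<close>

text \<open>
  \<open>standard_simplex n\<close> consists of sequences vanishing beyond index \<open>n\<close>; on these the product
  topology restricts to that of \<open>\<real>\<^sup>n\<^sup>+\<^sup>1\<close>.
\<close>

definition simplex_topology :: "nat \<Rightarrow> (nat \<Rightarrow> real) topology" where
  "simplex_topology n = subtopology (powertop_real UNIV) (standard_simplex n)"

definition simplex_push :: "nat \<Rightarrow> (nat \<Rightarrow> nat) \<Rightarrow> (nat \<Rightarrow> real) \<Rightarrow> (nat \<Rightarrow> real)" where
  "simplex_push n \<theta> t = (\<lambda>i. \<Sum>j | j \<le> n \<and> \<theta> j = i. t j)"

text \<open>
  The category \<open>\<Delta> \<down> X\<close>. An arrow from \<open>(n, f)\<close> to \<open>(m, g)\<close> is a morphism \<open>\<theta>\<close> from \<open>[n]\<close> to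
  \<open>[m]\<close> whose induced map of representable simplicial sets is compatible with \<open>f\<close> and \<open>g\<close>.
\<close>

definition simplex_objs :: "'a sset \<Rightarrow> (nat \<times> (nat \<Rightarrow> (nat \<Rightarrow> nat) \<Rightarrow> 'a)) set" where
  "simplex_objs X = {(n, f). f \<in> sset_hom (Delta_sset n) X}"

definition simplex_arrs ::
  "nat \<times> (nat \<Rightarrow> (nat \<Rightarrow> nat) \<Rightarrow> 'a) \<Rightarrow> nat \<times> (nat \<Rightarrow> (nat \<Rightarrow> nat) \<Rightarrow> 'a) \<Rightarrow> (nat \<Rightarrow> nat) set" where
  "simplex_arrs p q =
     {\<theta> \<in> Delta_hom (fst p) (fst q).
        sset_compose (Delta_sset (fst p)) (snd q) (Delta_sset_map (fst p) \<theta>) = snd p}"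

definition geometric_realization ::
  "'a sset \<Rightarrow> ((nat \<times> (nat \<Rightarrow> (nat \<Rightarrow> nat) \<Rightarrow> 'a)) \<times> (nat \<Rightarrow> real)) set topology" where
  "geometric_realization X =
     colim_topology (simplex_objs X) (\<lambda>p. simplex_topology (fst p)) simplex_arrs
       (\<lambda>p q \<theta>. simplex_push (fst p) \<theta>)"

lemma continuous_map_simplex_push:
  assumes "\<theta> \<in> Delta_hom n m"
  shows "continuous_map (simplex_topology n) (simplex_topology m) (simplex_push n \<theta>)"
proof -
  have \<theta>: "\<theta> j \<le> m" if "j \<le> n" for j
    using assms that by (auto simp: Delta_hom_def)
  have "simplex_push n \<theta> t \<in> standard_simplex m" if "t \<in> standard_simplex n" for t
  proof -
    have t: "0 \<le> t i" "(\<Sum>i\<le>n. t i) = 1" for i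
      using that by (auto simp: standard_simplex_def)
    have "(\<Sum>i\<le>m. simplex_push n \<theta> t i) = (\<Sum>i\<le>n. t i)"
      using sum.group[of "{..n}" "{..m}" \<theta> t] \<theta> by (auto simp: simplex_push_def image_subset_iff)
    moreover have "simplex_push n \<theta> t i \<le> (\<Sum>i\<le>n. t i)" for i
      unfolding simplex_push_def by (rule sum_mono2) (auto simp: t)
    moreover have "simplex_push n \<theta> t i = 0" if "i > m" for i
      unfolding simplex_push_def using \<theta> that by (intro sum.neutral) fastforce
    ultimately show ?thesis
      using t by (auto simp: standard_simplex_def simplex_push_def sum_nonneg)
  qed
  moreover have "continuous_map (subtopology (powertop_real UNIV) (standard_simplex n)) euclideanreal
      (\<lambda>t. simplex_push n \<theta> t i)" for i
    unfolding simplex_push_def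
    by (intro continuous_map_sum continuous_map_from_subtopology continuous_map_product_projection)
      auto
  ultimately show ?thesis
    by (auto simp: simplex_topology_def continuous_map_in_subtopology
        continuous_map_componentwise_UNIV topspace_standard_simplex)
qed

end

theory Submission
  imports Defs
begin

text \<open>
  A point of \<open>|\<Delta>\<^sub>n \<times> \<Delta>\<^sub>m|\<close> is given by a simplex \<open>(\<alpha>, \<beta>)\<close> of dimension \<open>k\<close> and a probability
  measure \<open>x\<close> on \<open>[k]\<close>, whose image on \<open>[n] \<times> [m]\<close> is supported on a chain. The canonical map
  sends it to the two marginals \<open>(s, t)\<close>. Since \<open>\<alpha>\<close> and \<open>\<beta>\<close> are monotone, the image measure is
  the monotone coupling of \<open>s\<close> and \<open>t\<close>, hence determined by them. Its support extends to an
  \<open>(n + m)\<close>-simplex of the product, graded by \<open>a + b\<close>, and every representative with the same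
  marginals is connected to the resulting point of that simplex, via the support of \<open>x\<close>.
  So the canonical map is a continuous bijection; its source is compact, being covered by the
  finitely many \<open>(n + m)\<close>-simplices, and its target is Hausdorff.
\<close>

text \<open>A running maximum: \<open>g i\<close> is the largest \<open>f c\<close> with
  \<open>r c \<le> i\<close>. Hypothesis \<open>rf\<close> also forces \<open>f c = f c'\<close>
  whenever \<open>r c = r c'\<close>.\<close>

lemma monotone_extension:
  fixes r f :: "'a \<Rightarrow> nat"
  assumes "finite C" "C \<noteq> {}"
    and rf: "\<And>c c'. \<lbrakk>c \<in> C; c' \<in> C; r c \<le> r c'\<rbrakk> \<Longrightarrow> f c \<le> f c'"
  obtains g where "mono g" "\<And>c. c \<in> C \<Longrightarrow> g (r c) = f c" "\<And>i. g i \<in> f ` C"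
proof
  \<comment> \<open>The least value is a default for \<open>i\<close> below every
    \<open>r c\<close>; it keeps \<open>D i\<close> nonempty and changes no other maximum.\<close>
  define D where "D i = insert (Min (f ` C)) (f ` {c \<in> C. r c \<le> i})" for i
  have fin: "finite (D i)" "D i \<noteq> {}" for i
    using assms(1) by (simp_all add: D_def)
  have "D i \<subseteq> f ` C" for i
    using assms(1,2) Min_in[of "f ` C"] by (auto simp: D_def)
  then show "Max (D i) \<in> f ` C" for i
    using Max_in[OF fin] by blast
  show "mono (\<lambda>i. Max (D i))"
    by (intro monoI Max_mono fin) (auto simp: D_def)
  show "Max (D (r c)) = f c" if "c \<in> C" for c
    by (rule Max_eqI) (use that assms(1) rf in \<open>auto simp: D_def\<close>)
qed


section \<open>Monotone couplings\<close>

text \<open>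
  The weight of \<open>(a, b)\<close> is the length of the overlap of the intervals \<open>[S\<^sub>a, S\<^sub>a\<^sub>+\<^sub>1]\<close> and
  \<open>[T\<^sub>b, T\<^sub>b\<^sub>+\<^sub>1]\<close>, where \<open>S\<close> and \<open>T\<close> are the partial sums of \<open>s\<close> and \<open>t\<close>.
\<close>

definition min_cdf :: "(nat \<Rightarrow> real) \<Rightarrow> (nat \<Rightarrow> real) \<Rightarrow> nat \<Rightarrow> nat \<Rightarrow> real" where
  "min_cdf s t a b = min (\<Sum>i<a. s i) (\<Sum>i<b. t i)"

definition coupling :: "(nat \<Rightarrow> real) \<Rightarrow> (nat \<Rightarrow> real) \<Rightarrow> nat \<Rightarrow> nat \<Rightarrow> real" where
  "coupling s t a b =
     min_cdf s t (Suc a) (Suc b) - min_cdf s t a (Suc b) - min_cdf s t (Suc a) b + min_cdf s t a b"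

lemma coupling_commute: "coupling s t a b = coupling t s b a"
  by (simp add: coupling_def min_cdf_def min.commute)

text \<open>For distributions \<open>s\<close> and \<open>t\<close>, \<open>min_cdf\<close> is the
  joint distribution function of the comonotone coupling (the upper Frechet-Hoeffding bound); its
  mixed differences are overlap lengths, so they cannot be negative.\<close>

lemma coupling_nonneg:
  assumes "0 \<le> s a" "0 \<le> t b"
  shows "0 \<le> coupling s t a b"
  using assms by (auto simp: coupling_def min_cdf_def min_def)

lemma coupling_pos_imp_less:
  assumes "0 \<le> s a" "0 \<le> t b" "0 < coupling s t a b"
  shows "(\<Sum>i<a. s i) < (\<Sum>i<Suc b. t i)" "(\<Sum>i<b. t i) < (\<Sum>i<Suc a. s i)"
  using assms by (auto simp: coupling_def min_cdf_def min_def split: if_splits)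

text \<open>Write \<open>S\<close>, \<open>T\<close> for the partial sums. If \<open>a' < a\<close>,
  then \<open>b < b'\<close>, and the overlaps give
  \<open>S (a'+1) \<le> S a < T (b+1) \<le> T b' < S (a'+1)\<close>. This is why
  \<open>a + b\<close> can serve as a rank on the support.\<close>

lemma coupling_support_chain:
  assumes s: "\<And>i. 0 \<le> s i" and t: "\<And>i. 0 \<le> t i"
    and pos: "0 < coupling s t a b" "0 < coupling s t a' b'"
    and le: "a + b \<le> a' + b'"
  shows "a \<le> a'"
proof (rule ccontr)
  assume "\<not> a \<le> a'"
  with le have "Suc a' \<le> a" "Suc b \<le> b'" by auto
  then have "(\<Sum>i<Suc a'. s i) \<le> (\<Sum>i<a. s i)" "(\<Sum>i<Suc b. t i) \<le> (\<Sum>i<b'. t i)"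
    using s t by (intro sum_mono2; auto)+
  with coupling_pos_imp_less[OF s t pos(1)] coupling_pos_imp_less[OF s t pos(2)]
  show False by linarith
qed

text \<open>Summing over \<open>b\<close> telescopes: at the bottom the empty sum of
  \<open>t\<close> cuts \<open>min_cdf\<close> to \<open>0\<close>, at the top the full mass
  \<open>1\<close> of \<open>t\<close> leaves the partial sums of \<open>s\<close>.\<close>

lemma sum_coupling:
  assumes s: "s \<in> standard_simplex n" and t: "t \<in> standard_simplex m" and "a \<le> n"
  shows "(\<Sum>b\<le>m. coupling s t a b) = s a"
proof -
  have nn: "0 \<le> s i" "(\<Sum>i\<le>n. s i) = 1" "0 \<le> t i" "(\<Sum>i\<le>m. t i) = 1" for i
    using s t by (auto simp: standard_simplex_def)
  have le1: "(\<Sum>i<c. s i) \<le> 1" if "c \<le> Suc n" for c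
    using sum_mono2[of "{..n}" "{..<c}" s] that nn by fastforce
  have "0 \<le> (\<Sum>i<c. s i)" for c
    using nn by (simp add: sum_nonneg)
  then have "(\<Sum>b\<le>m. coupling s t a b)
      = min_cdf s t (Suc a) (Suc m) - min_cdf s t a (Suc m)"
    unfolding lessThan_Suc_atMost[symmetric] coupling_def
    using sum_lessThan_telescope[of "\<lambda>b. min_cdf s t (Suc a) b - min_cdf s t a b" "Suc m"]
    by (simp add: algebra_simps min_cdf_def del: sum.lessThan_Suc)
  also have "\<dots> = (\<Sum>i<Suc a. s i) - (\<Sum>i<a. s i)"
    using le1[of a] le1[of "Suc a"] \<open>a \<le> n\<close> nn
    by (simp add: min_cdf_def lessThan_Suc_atMost del: sum.lessThan_Suc)
  also have "\<dots> = s a"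
    by simp
  finally show ?thesis .
qed

lemma sum_simplex_push:
  "(\<Sum>i<a. simplex_push k \<alpha> x i) = (\<Sum>j\<le>k. if \<alpha> j < a then x j else 0)"
proof -
  have "(\<Sum>i<a. simplex_push k \<alpha> x i) = (\<Sum>i<a. \<Sum>j\<le>k. if \<alpha> j = i then x j else 0)"
    unfolding simplex_push_def by (simp add: sum.inter_filter[symmetric])
  also have "\<dots> = (\<Sum>j\<le>k. \<Sum>i<a. if \<alpha> j = i then x j else 0)"
    by (rule sum.swap)
  finally show ?thesis by simp
qed

text \<open>
  The sets \<open>{j. \<alpha> j < a}\<close> and \<open>{j. \<beta> j < b}\<close> are initial segments, hence nested; so the mass of
  their intersection is the smaller of their masses.
\<close>

lemma min_cdf_simplex_push:
  assumes \<alpha>: "mono_on {..k} \<alpha>" and \<beta>: "mono_on {..k} \<beta>" and x: "\<And>j. 0 \<le> x j"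
  shows "min_cdf (simplex_push k \<alpha> x) (simplex_push k \<beta> x) a b
           = (\<Sum>j\<le>k. if \<alpha> j < a \<and> \<beta> j < b then x j else 0)"
proof -
  consider "\<forall>j\<le>k. \<alpha> j < a \<longrightarrow> \<beta> j < b" | "\<forall>j\<le>k. \<beta> j < b \<longrightarrow> \<alpha> j < a"
  proof (rule ccontr)
    assume "\<not> thesis"
    with that obtain i j where ij: "i \<le> k" "\<alpha> i < a" "\<not> \<beta> i < b" "j \<le> k" "\<beta> j < b" "\<not> \<alpha> j < a"
      by blast
    \<comment> \<open>If \<open>i \<le> j\<close> this contradicts monotonicity of
      \<open>\<beta>\<close>, and if \<open>j \<le> i\<close> that of
      \<open>\<alpha>\<close>.\<close>
    show False
      using ij mono_onD[OF \<alpha>, of i j] mono_onD[OF \<alpha>, of j i]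
        mono_onD[OF \<beta>, of i j] mono_onD[OF \<beta>, of j i] by (cases i j rule: linorder_cases) auto
  qed
  then show ?thesis
  proof cases
    case 1
    then show ?thesis
      unfolding min_cdf_def sum_simplex_push
      by (subst min_absorb1) (auto intro!: sum_mono sum.cong simp: x)
  next
    case 2
    then show ?thesis
      unfolding min_cdf_def sum_simplex_push
      by (subst min_absorb2) (auto intro!: sum_mono sum.cong simp: x)
  qed
qed

text \<open>The mixed difference of the indicator of
  \<open>\<alpha> j < a \<and> \<beta> j < b\<close> is the indicator of equality in both. Thus the
  image of \<open>x\<close> under the pair depends only on its marginals.\<close>

lemma coupling_simplex_push:
  assumes "mono_on {..k} \<alpha>" "mono_on {..k} \<beta>" "\<And>j. 0 \<le> x j"
  shows "coupling (simplex_push k \<alpha> x) (simplex_push k \<beta> x) a b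
           = (\<Sum>j\<le>k. if \<alpha> j = a \<and> \<beta> j = b then x j else 0)"
  unfolding coupling_def min_cdf_simplex_push[OF assms] sum_subtractf[symmetric] sum.distrib[symmetric]
  by (rule sum.cong) auto


section \<open>A canonical simplex through a point\<close>

text \<open>
  For \<open>x\<close> in a \<open>k\<close>-simplex \<open>(\<alpha>, \<beta>)\<close> over \<open>(s, t)\<close>, the map \<open>\<rho>\<close> retracts \<open>[k]\<close> onto the support
  of \<open>x\<close>, and \<open>\<theta>\<close> sends \<open>j\<close> to the rank \<open>\<alpha> (\<rho> j) + \<beta> (\<rho> j)\<close>.
\<close>

lemma canonical_simplex:
  assumes s: "s \<in> standard_simplex n" and t: "t \<in> standard_simplex m"
  obtains p q z where
    "p \<in> Delta_hom (n + m) n" "q \<in> Delta_hom (n + m) m" "z \<in> standard_simplex (n + m)"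
    "simplex_push (n + m) p z = s" "simplex_push (n + m) q z = t"
    "\<And>k \<alpha> \<beta> x. \<lbrakk>\<alpha> \<in> Delta_hom k n; \<beta> \<in> Delta_hom k m; x \<in> standard_simplex k;
         simplex_push k \<alpha> x = s; simplex_push k \<beta> x = t\<rbrakk> \<Longrightarrow>
       \<exists>\<rho>\<in>Delta_hom k k. \<exists>\<theta>\<in>Delta_hom k (n + m).
         simplex_push k \<rho> x = x \<and> simplex_push k \<theta> x = z \<and>
         compose {..k} p \<theta> = compose {..k} \<alpha> \<rho> \<and> compose {..k} q \<theta> = compose {..k} \<beta> \<rho>"
proof -
  define w where "w = coupling s t"
  define C where "C = {(a, b) \<in> {..n} \<times> {..m}. 0 < w a b}"
  define z where "z i = (\<Sum>(a, b) \<in> {..n} \<times> {..m}. if a + b = i then w a b else 0)" for i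
  have nn: "0 \<le> s i" "(\<Sum>i\<le>n. s i) = 1" "0 \<le> t i" "(\<Sum>i\<le>m. t i) = 1" for i
    using s t by (auto simp: standard_simplex_def)
  have s0: "s i = 0" if "\<not> i \<le> n" for i
    using s that by (auto simp: standard_simplex_def)
  have t0: "t i = 0" if "\<not> i \<le> m" for i
    using t that by (auto simp: standard_simplex_def)
  have w0: "0 \<le> w a b" for a b
    by (simp add: w_def coupling_nonneg nn)
  have rows: "(\<Sum>b\<le>m. w a b) = s a" if "a \<le> n" for a
    using sum_coupling[OF s t that] by (simp add: w_def)
  have cols: "(\<Sum>a\<le>n. w a b) = t b" if "b \<le> m" for b
    using sum_coupling[OF t s that] by (simp add: w_def coupling_commute[of s])
  have total: "(\<Sum>(a, b) \<in> {..n} \<times> {..m}. w a b) = 1"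
    using rows nn by (simp add: sum.cartesian_product[symmetric])
  have finC: "finite C"
    by (rule finite_subset[of _ "{..n} \<times> {..m}"]) (auto simp: C_def)
  have C_ne: "C \<noteq> {}"
  proof
    assume "C = {}"
    then have "w a b = 0" if "a \<le> n" "b \<le> m" for a b
      using that w0[of a b] by (force simp: C_def)
    then have "(\<Sum>(a, b) \<in> {..n} \<times> {..m}. w a b) = 0"
      by (intro sum.neutral) auto
    with total show False by simp
  qed
  \<comment> \<open>\<open>coupling_support_chain\<close> is applied in both orders of the
    marginals; in particular \<open>a + b\<close> is injective on \<open>C\<close>.\<close>
  have chain: "fst c \<le> fst c'" "snd c \<le> snd c'"
    if "c \<in> C" "c' \<in> C" "fst c + snd c \<le> fst c' + snd c'" for c c'
    using that coupling_support_chain[of s t "fst c" "snd c" "fst c'" "snd c'"]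
      coupling_support_chain[of t s "snd c" "fst c" "snd c'" "fst c'"] nn
    by (auto simp: C_def w_def coupling_commute[of s])
  \<comment> \<open>On \<open>C\<close>, \<open>p\<close> and \<open>q\<close> decode a rank into
    coordinates; elsewhere only monotonicity and the range matter, so that \<open>(p, q)\<close>
    restricts to an \<open>(n + m)\<close>-simplex.\<close>
  obtain p where p: "mono p" "\<And>c. c \<in> C \<Longrightarrow> p (fst c + snd c) = fst c" "\<And>i. p i \<in> fst ` C"
    by (rule monotone_extension[where r = "\<lambda>c. fst c + snd c" and f = fst, OF finC C_ne chain(1)])
      blast+
  obtain q where q: "mono q" "\<And>c. c \<in> C \<Longrightarrow> q (fst c + snd c) = snd c" "\<And>i. q i \<in> snd ` C"
    by (rule monotone_extension[where r = "\<lambda>c. fst c + snd c" and f = snd, OF finC C_ne chain(2)])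
      blast+
  define p' q' where "p' = restrict p {..n+m}" and "q' = restrict q {..n+m}"
  have p': "p' \<in> Delta_hom (n + m) n" and q': "q' \<in> Delta_hom (n + m) m"
    using p(1,3) q(1,3) by (fastforce simp: p'_def q'_def Delta_hom_def C_def mono_on_def mono_def)+
  have z_sum: "(\<Sum>i | i \<le> n + m \<and> P i. z i)
      = (\<Sum>(a, b) \<in> {..n} \<times> {..m}. if P (a + b) then w a b else 0)" for P
  proof -
    have "(\<Sum>i | i \<le> n + m \<and> P i. z i) = (\<Sum>c \<in> {..n} \<times> {..m}. \<Sum>i | i \<le> n + m \<and> P i.
        if fst c + snd c = i then w (fst c) (snd c) else 0)"
      unfolding z_def case_prod_unfold by (rule sum.swap)
    also have "\<dots> = (\<Sum>(a, b) \<in> {..n} \<times> {..m}. if P (a + b) then w a b else 0)"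
      by (rule sum.cong) auto
    finally show ?thesis .
  qed
  have z: "z \<in> standard_simplex (n + m)"
  proof -
    have z0: "0 \<le> z i" for i
      unfolding z_def by (rule sum_nonneg) (auto simp: w0)
    moreover have z1: "(\<Sum>i\<le>n+m. z i) = 1"
      using z_sum[of "\<lambda>_. True"] total by (simp add: atMost_def)
    moreover have "z i = 0" if "i > n + m" for i
      unfolding z_def using that by (intro sum.neutral) auto
    moreover have "z i \<le> 1" for i
      unfolding total[symmetric] z_def by (rule sum_mono) (auto simp: w0)
    ultimately show ?thesis
      by (auto simp: standard_simplex_def)
  qed
  have notC: "w a b = 0" if "a \<le> n" "b \<le> m" "(a, b) \<notin> C" for a b
    using that w0[of a b] by (force simp: C_def)
  have push_p: "simplex_push (n + m) p' z = s"
  proof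
    fix i
    have "simplex_push (n + m) p' z i
        = (\<Sum>(a, b) \<in> {..n} \<times> {..m}. if p (a + b) = i then w a b else 0)"
    proof -
      have "{j. j \<le> n + m \<and> p' j = i} = {j. j \<le> n + m \<and> p j = i}"
        by (auto simp: p'_def)
      then show ?thesis
        unfolding simplex_push_def z_sum[of "\<lambda>j. p j = i", symmetric] by (simp only:)
    qed
    \<comment> \<open>Where \<open>p (a + b) \<noteq> a\<close>, the pair lies outside
      \<open>C\<close> and carries no weight.\<close>
    also have "\<dots> = (\<Sum>(a, b) \<in> {..n} \<times> {..m}. if a = i then w a b else 0)"
      using p(2) notC by (intro sum.cong) fastforce+
    also have "\<dots> = (\<Sum>a\<le>n. if a = i then \<Sum>b\<le>m. w a b else 0)"
      unfolding sum.cartesian_product[symmetric] by (rule sum.cong) auto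
    also have "\<dots> = s i"
      using s0 rows by auto
    finally show "simplex_push (n + m) p' z i = s i" .
  qed
  have push_q: "simplex_push (n + m) q' z = t"
  proof
    fix i
    have "simplex_push (n + m) q' z i
        = (\<Sum>(a, b) \<in> {..n} \<times> {..m}. if q (a + b) = i then w a b else 0)"
    proof -
      have "{j. j \<le> n + m \<and> q' j = i} = {j. j \<le> n + m \<and> q j = i}"
        by (auto simp: q'_def)
      then show ?thesis
        unfolding simplex_push_def z_sum[of "\<lambda>j. q j = i", symmetric] by (simp only:)
    qed
    also have "\<dots> = (\<Sum>(a, b) \<in> {..n} \<times> {..m}. if b = i then w a b else 0)"
      using q(2) notC by (intro sum.cong) fastforce+
    also have "\<dots> = (\<Sum>a\<le>n. \<Sum>b\<le>m. if b = i then w a b else 0)"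
      by (rule sum.cartesian_product[symmetric])
    also have "\<dots> = t i"
      using t0 cols by (cases "i \<le> m") auto
    finally show "simplex_push (n + m) q' z i = t i" .
  qed
  show thesis
  proof (rule that[OF p' q' z push_p push_q])
    fix k \<alpha> \<beta> x
    assume \<alpha>: "\<alpha> \<in> Delta_hom k n" and \<beta>: "\<beta> \<in> Delta_hom k m" and x: "x \<in> standard_simplex k"
      and xs: "simplex_push k \<alpha> x = s" and xt: "simplex_push k \<beta> x = t"
    have x0: "0 \<le> x j" and x1: "(\<Sum>j\<le>k. x j) = 1" and xk: "j > k \<Longrightarrow> x j = 0" for j
      using x by (auto simp: standard_simplex_def)
    have \<alpha>_mono: "mono_on {..k} \<alpha>" and \<beta>_mono: "mono_on {..k} \<beta>"
      and \<alpha>_le: "j \<le> k \<Longrightarrow> \<alpha> j \<le> n" and \<beta>_le: "j \<le> k \<Longrightarrow> \<beta> j \<le> m" for j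
      using \<alpha> \<beta> by (auto simp: Delta_hom_def)
    \<comment> \<open>The weights computed from \<open>s\<close> and \<open>t\<close> agree with
      those induced by this arbitrary representative.\<close>
    have w_eq: "w a b = (\<Sum>j\<le>k. if \<alpha> j = a \<and> \<beta> j = b then x j else 0)" for a b
      using coupling_simplex_push[OF \<alpha>_mono \<beta>_mono, of x] x0 by (simp add: w_def xs xt)
    define J where "J = {j \<in> {..k}. 0 < x j}"
    have J_ne: "J \<noteq> {}"
    proof
      assume "J = {}"
      then have "x j = 0" if "j \<le> k" for j
        using that x0[of j] by (force simp: J_def)
      with x1 show False by simp
    qed
    have "finite J"
      by (simp add: J_def)
    \<comment> \<open>Extending the identity on the support \<open>J\<close> yields a monotone
      retraction onto it.\<close>
    then obtain r where "mono r" "\<And>j. j \<in> J \<Longrightarrow> r j = j" "\<And>i. r i \<in> (\<lambda>j. j) ` J"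
      by (rule monotone_extension[OF _ J_ne, where r = "\<lambda>j. j" and f = "\<lambda>j. j"]) blast+
    then have r: "mono r" "\<And>j. j \<in> J \<Longrightarrow> r j = j" "\<And>i. r i \<in> J"
      by simp_all
    have r_le: "r j \<le> k" for j
      using r(3)[of j] by (simp add: J_def)
    define \<rho> where "\<rho> = restrict r {..k}"
    have \<rho>: "\<rho> \<in> Delta_hom k k"
      using r(1) r_le by (auto simp: \<rho>_def Delta_hom_def mono_on_def mono_def)
    \<comment> \<open>Passing through \<open>r\<close> matters: for \<open>j\<close> outside
      \<open>J\<close> the pair \<open>(\<alpha> j, \<beta> j)\<close> may miss \<open>C\<close>,
      where \<open>p\<close> and \<open>q\<close> need not decode its rank.\<close>
    define \<theta> where "\<theta> = (\<lambda>j\<in>{..k}. \<alpha> (r j) + \<beta> (r j))"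
    have \<theta>: "\<theta> \<in> Delta_hom k (n + m)"
      unfolding Delta_hom_def \<theta>_def
      using mono_onD[OF \<alpha>_mono] mono_onD[OF \<beta>_mono] monoD[OF r(1)] r_le \<alpha>_le \<beta>_le
      by (auto simp: mono_on_def intro!: add_mono)
    have x_notJ: "x j = 0" if "j \<le> k" "j \<notin> J" for j
      using that x0[of j] by (force simp: J_def)
    have in_C: "(\<alpha> (r j), \<beta> (r j)) \<in> C" for j
    proof -
      have "0 < x (r j)"
        using r(3)[of j] by (simp add: J_def)
      also have "\<dots> = (\<Sum>i\<in>{r j}. if \<alpha> i = \<alpha> (r j) \<and> \<beta> i = \<beta> (r j) then x i else 0)"
        by simp
      also have "\<dots> \<le> w (\<alpha> (r j)) (\<beta> (r j))"
        unfolding w_eq by (rule sum_mono2) (use r_le x0 in auto)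
      finally show ?thesis
        using r_le \<alpha>_le \<beta>_le by (simp add: C_def)
    qed
    have "simplex_push k \<rho> x = x"
    proof
      fix i
      have "simplex_push k \<rho> x i = (\<Sum>j\<le>k. if \<rho> j = i then x j else 0)"
        by (simp add: simplex_push_def sum.inter_filter[symmetric])
      also have "\<dots> = (\<Sum>j\<le>k. if j = i then x j else 0)"
        using r(2) x_notJ by (intro sum.cong) (fastforce simp: \<rho>_def)+
      also have "\<dots> = x i"
        using xk by auto
      finally show "simplex_push k \<rho> x i = x i" .
    qed
    moreover have "simplex_push k \<theta> x = z"
    proof
      fix i
      \<comment> \<open>Each \<open>j\<close> is counted at the one pair
        \<open>(\<alpha> j, \<beta> j)\<close>, so exchanging the sums removes the pairs.\<close>
      have "z i = (\<Sum>c \<in> {..n} \<times> {..m}. \<Sum>j\<le>k.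
          if c = (\<alpha> j, \<beta> j) then (if \<alpha> j + \<beta> j = i then x j else 0) else 0)"
        unfolding z_def w_eq by (intro sum.cong) (auto intro!: sum.cong sum.neutral)
      also have "\<dots> = (\<Sum>j\<le>k. \<Sum>c \<in> {..n} \<times> {..m}.
          if c = (\<alpha> j, \<beta> j) then (if \<alpha> j + \<beta> j = i then x j else 0) else 0)"
        by (rule sum.swap)
      also have "\<dots> = (\<Sum>j\<le>k. if \<alpha> j + \<beta> j = i then x j else 0)"
        using \<alpha>_le \<beta>_le by (intro sum.cong) auto
      also have "\<dots> = (\<Sum>j\<le>k. if \<theta> j = i then x j else 0)"
        using r(2) x_notJ by (intro sum.cong) (fastforce simp: \<theta>_def)+
      also have "\<dots> = simplex_push k \<theta> x i"
        by (simp add: simplex_push_def sum.inter_filter[symmetric])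
      finally show "simplex_push k \<theta> x i = z i" ..
    qed
    \<comment> \<open>Equality holds on all of \<open>[k]\<close>, not only on the support, because
      \<open>in_C\<close> holds for every \<open>j\<close>.\<close>
    moreover have "compose {..k} p' \<theta> = compose {..k} \<alpha> \<rho>"
      using p(2)[OF in_C] \<alpha>_le[OF r_le] \<beta>_le[OF r_le]
      by (auto simp: compose_def fun_eq_iff p'_def \<theta>_def \<rho>_def add_mono)
    moreover have "compose {..k} q' \<theta> = compose {..k} \<beta> \<rho>"
      using q(2)[OF in_C] \<alpha>_le[OF r_le] \<beta>_le[OF r_le]
      by (auto simp: compose_def fun_eq_iff q'_def \<theta>_def \<rho>_def add_mono)
    ultimately show "\<exists>\<rho>\<in>Delta_hom k k. \<exists>\<theta>\<in>Delta_hom k (n + m).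
         simplex_push k \<rho> x = x \<and> simplex_push k \<theta> x = z \<and>
         compose {..k} p' \<theta> = compose {..k} \<alpha> \<rho> \<and> compose {..k} q' \<theta> = compose {..k} \<beta> \<rho>"
      using \<rho> \<theta> by blast
  qed
qed


section \<open>Points of a realization\<close>

text \<open>The map from the standard simplex classified by \<open>x\<close>, made extensional at
  each level as \<open>sset_hom\<close> requires.\<close>

definition yoneda :: "'a sset \<Rightarrow> nat \<Rightarrow> 'a \<Rightarrow> nat \<Rightarrow> (nat \<Rightarrow> nat) \<Rightarrow> 'a" where
  "yoneda X k x = (\<lambda>l. \<lambda>\<sigma> \<in> Delta_hom l k. pullback X l k \<sigma> x)"

lemma compose_Delta_hom_id:
  assumes "\<theta> \<in> Delta_hom n m"
  shows "compose {..n} \<theta> (\<lambda>i\<in>{..n}. i) = \<theta>" "compose {..n} (\<lambda>i\<in>{..m}. i) \<theta> = \<theta>"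
  using assms by (auto simp: Delta_hom_def compose_def fun_eq_iff PiE_def extensional_def)

context simplicial_set
begin

lemma yoneda_in_sset_hom:
  assumes "x \<in> simplices X k"
  shows "yoneda X k x \<in> sset_hom (Delta_sset k) X"
  using assms
  by (auto simp: sset_hom_def yoneda_def Delta_sset_def pullback_closed pullback_compose
      Delta_hom_compose)

lemma yoneda_at_id:
  assumes "x \<in> simplices X k"
  shows "yoneda X k x k (\<lambda>i\<in>{..k}. i) = x"
  using assms by (simp add: yoneda_def Delta_hom_id pullback_id)

text \<open>Any \<open>\<sigma>\<close> is the identity of \<open>[k]\<close> composed with
  \<open>\<sigma>\<close>, so naturality determines \<open>f\<close> from its value at that
  identity.\<close>

lemma sset_hom_eq_yoneda:
  assumes "f \<in> sset_hom (Delta_sset k) X"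
  shows "f k (\<lambda>i\<in>{..k}. i) \<in> simplices X k" "f = yoneda X k (f k (\<lambda>i\<in>{..k}. i))"
proof -
  have f: "f l \<in> Delta_hom l k \<rightarrow>\<^sub>E simplices X l" for l
    using assms by (simp add: sset_hom_def Delta_sset_def)
  then show "f k (\<lambda>i\<in>{..k}. i) \<in> simplices X k"
    using Delta_hom_id by blast
  show "f = yoneda X k (f k (\<lambda>i\<in>{..k}. i))"
  proof (intro ext)
    fix l \<sigma>
    show "f l \<sigma> = yoneda X k (f k (\<lambda>i\<in>{..k}. i)) l \<sigma>"
    proof (cases "\<sigma> \<in> Delta_hom l k")
      case True
      with assms have "f l (compose {..l} (\<lambda>i\<in>{..k}. i) \<sigma>) = pullback X l k \<sigma> (f k (\<lambda>i\<in>{..k}. i))"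
        by (simp add: sset_hom_def Delta_sset_def Delta_hom_id)
      with True show ?thesis
        by (simp add: yoneda_def compose_Delta_hom_id)
    next
      case False
      with f[of l] show ?thesis
        by (auto simp: yoneda_def PiE_def extensional_def)
    qed
  qed
qed

text \<open>Precomposition with \<open>\<theta>\<close> corresponds to pulling back
  \<open>y\<close>, and evaluation at the identity shows that equal Yoneda maps come from equal
  simplices.\<close>

lemma simplex_arrs_yoneda:
  assumes "x \<in> simplices X k" "y \<in> simplices X l"
  shows "simplex_arrs (k, yoneda X k x) (l, yoneda X l y) = {\<theta> \<in> Delta_hom k l. pullback X k l \<theta> y = x}"
proof -
  have "sset_compose (Delta_sset k) (yoneda X l y) (Delta_sset_map k \<theta>) = yoneda X k (pullback X k l \<theta> y)"
    if "\<theta> \<in> Delta_hom k l" for \<theta>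
    using that assms
    by (auto simp: sset_compose_def Delta_sset_map_def yoneda_def Delta_sset_def fun_eq_iff
        compose_def[of "Delta_hom _ _"] Delta_hom_compose pullback_compose)
  then show ?thesis
    using assms by (auto simp: simplex_arrs_def) (metis yoneda_at_id pullback_closed)
qed

end

definition realization_point ::
  "'a sset \<Rightarrow> nat \<Rightarrow> 'a \<Rightarrow> (nat \<Rightarrow> real) \<Rightarrow>
     ((nat \<times> (nat \<Rightarrow> (nat \<Rightarrow> nat) \<Rightarrow> 'a)) \<times> (nat \<Rightarrow> real)) set" where
  "realization_point X k x =
     colim_in (simplex_objs X) (\<lambda>p. simplex_topology (fst p)) simplex_arrs
       (\<lambda>p q \<theta>. simplex_push (fst p) \<theta>) (k, yoneda X k x)"

lemma topspace_simplex_topology [simp]: "topspace (simplex_topology n) = standard_simplex n"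
  by (simp add: simplex_topology_def)

context simplicial_set
begin

lemma simplex_objs_eq_yoneda:
  "simplex_objs X = {(k, yoneda X k x) |k x. x \<in> simplices X k}"
  using sset_hom_eq_yoneda yoneda_in_sset_hom by (auto simp: simplex_objs_def) blast

lemma continuous_map_realization_point:
  assumes "x \<in> simplices X k"
  shows "continuous_map (simplex_topology k) (geometric_realization X) (realization_point X k x)"
  unfolding geometric_realization_def realization_point_def
  using continuous_map_colim_in[of "(k, yoneda X k x)" "simplex_objs X" "\<lambda>p. simplex_topology (fst p)"]
    assms by (auto simp: simplex_objs_eq_yoneda)

text \<open>\<open>\<theta>\<close> is an arrow from the pulled back simplex to \<open>x\<close>, so
  this is the gluing relation of the colimit.\<close>

lemma realization_point_push:
  assumes "\<theta> \<in> Delta_hom k l" "x \<in> simplices X l" "t \<in> standard_simplex k"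
  shows "realization_point X l x (simplex_push k \<theta> t) = realization_point X k (pullback X k l \<theta> x) t"
proof -
  have "simplex_push k \<theta> t \<in> standard_simplex l"
    using continuous_map_simplex_push[OF assms(1)] assms(3) by (auto simp: continuous_map_def)
  moreover have obj: "(k, yoneda X k (pullback X k l \<theta> x)) \<in> simplex_objs X"
      "(l, yoneda X l x) \<in> simplex_objs X"
    using assms pullback_closed by (auto simp: simplex_objs_eq_yoneda)
  moreover have "\<theta> \<in> simplex_arrs (k, yoneda X k (pullback X k l \<theta> x)) (l, yoneda X l x)"
    using assms by (simp add: simplex_arrs_yoneda pullback_closed)
  ultimately show ?thesis
    using assms(3) colim_in_commutes[OF obj, of \<theta> simplex_arrs t
        "\<lambda>p. simplex_topology (fst p)" "\<lambda>p q \<theta>. simplex_push (fst p) \<theta>"]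
    by (simp add: realization_point_def)
qed

lemma topspace_geometric_realization:
  "topspace (geometric_realization X)
     = {realization_point X k x t |k x t. x \<in> simplices X k \<and> t \<in> standard_simplex k}"
  using quotient_imp_surjective_map[OF quotient_map_colim, symmetric,
      of "simplex_objs X" "\<lambda>p. simplex_topology (fst p)" simplex_arrs "\<lambda>p q \<theta>. simplex_push (fst p) \<theta>"]
  by (force simp: geometric_realization_def realization_point_def simplex_objs_eq_yoneda)

text \<open>The universal property with cocones indexed by simplices of \<open>X\<close> instead of
  maps into \<open>X\<close>.\<close>

lemma realization_universal:
  assumes h: "\<And>k x. x \<in> simplices X k \<Longrightarrow> continuous_map (simplex_topology k) Y (h k x)"
    and comm: "\<And>k l \<theta> x t. \<lbrakk>\<theta> \<in> Delta_hom k l; x \<in> simplices X l; t \<in> standard_simplex k\<rbrakk> \<Longrightarrow>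
        h l x (simplex_push k \<theta> t) = h k (pullback X k l \<theta> x) t"
  obtains u where "continuous_map (geometric_realization X) Y u"
    "\<And>k x t. \<lbrakk>x \<in> simplices X k; t \<in> standard_simplex k\<rbrakk> \<Longrightarrow> u (realization_point X k x t) = h k x t"
proof -
  define h' where "h' p = h (fst p) (snd p (fst p) (\<lambda>i\<in>{..fst p}. i))" for p
  have h'_yoneda: "h' (k, yoneda X k x) = h k x" if "x \<in> simplices X k" for k x
    using that by (simp add: h'_def yoneda_at_id)
  have "\<exists>u. continuous_map (geometric_realization X) Y u \<and>
      (\<forall>p\<in>simplex_objs X. \<forall>t\<in>topspace (simplex_topology (fst p)).
        u (colim_in (simplex_objs X) (\<lambda>p. simplex_topology (fst p)) simplex_arrs
          (\<lambda>p q \<theta>. simplex_push (fst p) \<theta>) p t) = h' p t)"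
    unfolding geometric_realization_def
    by (rule colim_universal)
      (auto simp: simplex_objs_eq_yoneda h'_yoneda h simplex_arrs_yoneda comm)
  then show thesis
    using that by (force simp: simplex_objs_eq_yoneda realization_point_def h'_yoneda)
qed

end

section \<open>Functoriality of pushforwards, topology of simplices, finiteness of morphism
  sets\<close>

lemma simplex_push_compose:
  assumes "\<theta> \<in> Delta_hom k l"
  shows "simplex_push l \<alpha> (simplex_push k \<theta> t) = simplex_push k (compose {..k} \<alpha> \<theta>) t"
proof
  fix i
  have \<theta>: "\<theta> j \<le> l" if "j \<le> k" for j
    using assms that by (auto simp: Delta_hom_def)
  have "simplex_push l \<alpha> (simplex_push k \<theta> t) i
      = (\<Sum>a\<le>l. if \<alpha> a = i then \<Sum>j\<le>k. if \<theta> j = a then t j else 0 else 0)"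
    by (simp add: simplex_push_def sum.inter_filter[symmetric])
  also have "\<dots>
      = (\<Sum>a\<le>l. \<Sum>j\<le>k. if \<theta> j = a then (if \<alpha> (\<theta> j) = i then t j else 0) else 0)"
    by (intro sum.cong) (auto intro!: sum.cong sum.neutral)
  also have "\<dots> = (\<Sum>j\<le>k. \<Sum>a\<le>l. if \<theta> j = a then (if \<alpha> (\<theta> j) = i then t j else 0) else 0)"
    by (rule sum.swap)
  also have "\<dots> = (\<Sum>j\<le>k. if compose {..k} \<alpha> \<theta> j = i then t j else 0)"
    using \<theta> by (intro sum.cong) (auto simp: compose_def)
  also have "\<dots> = simplex_push k (compose {..k} \<alpha> \<theta>) t i"
    by (simp add: simplex_push_def sum.inter_filter[symmetric])
  finally show "simplex_push l \<alpha> (simplex_push k \<theta> t) i = simplex_push k (compose {..k} \<alpha> \<theta>) t i" .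
qed

lemma compact_space_simplex_topology: "compact_space (simplex_topology n)"
  by (simp add: simplex_topology_def compact_space_subtopology compactin_standard_simplex)

lemma Hausdorff_space_simplex_topology: "Hausdorff_space (simplex_topology n)"
  by (simp add: simplex_topology_def Hausdorff_space_subtopology Hausdorff_space_product_topology)

lemma finite_Delta_hom: "finite (Delta_hom n m)"
  by (rule finite_subset[of _ "{..n} \<rightarrow>\<^sub>E {..m}"]) (auto simp: Delta_hom_def intro: finite_PiE)

section \<open>Bijectivity of the canonical map and compactness of its source\<close>

theorem corollary3p8:
  fixes n m :: nat
  shows "geometric_realization (sset_prod (Delta_sset n) (Delta_sset m))
           homeomorphic_space prod_topology (simplex_topology n) (simplex_topology m)"
proof -
  define X where "X = sset_prod (Delta_sset n) (Delta_sset m)"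
  interpret simplicial_set X
    unfolding X_def by (intro simplicial_set_sset_prod simplicial_set_Delta_sset)
  have X: "simplices X k = Delta_hom k n \<times> Delta_hom k m"
    "pullback X k l \<theta> (\<alpha>, \<beta>) = (compose {..k} \<alpha> \<theta>, compose {..k} \<beta> \<theta>)" for k l \<theta> \<alpha> \<beta>
    by (simp_all add: X_def sset_prod_def Delta_sset_def)
  let ?Y = "prod_topology (simplex_topology n) (simplex_topology m)"
  \<comment> \<open>The components are the marginals of a point; \<open>simplex_push_compose\<close>
    makes them a cocone.\<close>
  obtain u where u: "continuous_map (geometric_realization X) ?Y u"
    and u_point: "\<And>k c t. \<lbrakk>c \<in> simplices X k; t \<in> standard_simplex k\<rbrakk> \<Longrightarrow>
      u (realization_point X k c t) = (simplex_push k (fst c) t, simplex_push k (snd c) t)"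
    by (rule realization_universal[of ?Y "\<lambda>k c t. (simplex_push k (fst c) t, simplex_push k (snd c) t)"])
      (auto simp: X continuous_map_pairwise o_def continuous_map_simplex_push simplex_push_compose)
  \<comment> \<open>One claim serves three ends: existence gives surjectivity, uniqueness gives
    injectivity, and the fixed dimension \<open>n + m\<close> gives a finite cover.\<close>
  have canonical: "\<exists>c\<in>simplices X (n + m). \<exists>z\<in>standard_simplex (n + m).
      u (realization_point X (n + m) c z) = y \<and>
      (\<forall>v\<in>topspace (geometric_realization X). u v = y \<longrightarrow> v = realization_point X (n + m) c z)"
    if y: "y \<in> topspace ?Y" for y
  proof -
    obtain s t where st: "y = (s, t)" "s \<in> standard_simplex n" "t \<in> standard_simplex m"
      using y by auto
    obtain p q z where pqz:
      "p \<in> Delta_hom (n + m) n" "q \<in> Delta_hom (n + m) m" "z \<in> standard_simplex (n + m)"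
      "simplex_push (n + m) p z = s" "simplex_push (n + m) q z = t"
      and can: "\<And>k \<alpha> \<beta> x. \<lbrakk>\<alpha> \<in> Delta_hom k n; \<beta> \<in> Delta_hom k m; x \<in> standard_simplex k;
         simplex_push k \<alpha> x = s; simplex_push k \<beta> x = t\<rbrakk> \<Longrightarrow>
       \<exists>\<rho>\<in>Delta_hom k k. \<exists>\<theta>\<in>Delta_hom k (n + m).
         simplex_push k \<rho> x = x \<and> simplex_push k \<theta> x = z \<and>
         compose {..k} p \<theta> = compose {..k} \<alpha> \<rho> \<and> compose {..k} q \<theta> = compose {..k} \<beta> \<rho>"
      using canonical_simplex[OF st(2,3)] by metis
    have unique: "realization_point X k c x = realization_point X (n + m) (p, q) z"
      if c: "c \<in> simplices X k" and x: "x \<in> standard_simplex k"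
        and eq: "u (realization_point X k c x) = y" for k c x
    proof -
      obtain \<alpha> \<beta> where \<alpha>\<beta>: "c = (\<alpha>, \<beta>)" "\<alpha> \<in> Delta_hom k n" "\<beta> \<in> Delta_hom k m"
        using c by (auto simp: X)
      with eq x c st have "simplex_push k \<alpha> x = s" "simplex_push k \<beta> x = t"
        by (simp_all add: u_point)
      from can[OF \<alpha>\<beta>(2,3) x this] obtain \<rho> \<theta> where \<rho>: "\<rho> \<in> Delta_hom k k" "simplex_push k \<rho> x = x"
        and \<theta>: "\<theta> \<in> Delta_hom k (n + m)" "simplex_push k \<theta> x = z"
        and eqs: "compose {..k} p \<theta> = compose {..k} \<alpha> \<rho>" "compose {..k} q \<theta> = compose {..k} \<beta> \<rho>"
        by blast
      \<comment> \<open>A zigzag of gluings: \<open>\<rho>\<close> fixes \<open>x\<close>, the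
        pullbacks along \<open>\<rho>\<close> and \<open>\<theta>\<close> coincide, and
        \<open>\<theta>\<close> carries \<open>x\<close> to \<open>z\<close>.\<close>
      have "realization_point X k c x = realization_point X k (pullback X k k \<rho> c) x"
        using realization_point_push[OF \<rho>(1) c x] \<rho>(2) by simp
      also have "pullback X k k \<rho> c = pullback X k (n + m) \<theta> (p, q)"
        by (simp add: X \<alpha>\<beta> eqs)
      also have "realization_point X k \<dots> x = realization_point X (n + m) (p, q) z"
        using realization_point_push[OF \<theta>(1) _ x, of "(p, q)"] pqz \<theta>(2) by (simp add: X)
      finally show ?thesis .
    qed
    have "\<forall>v\<in>topspace (geometric_realization X). u v = y \<longrightarrow> v = realization_point X (n + m) (p, q) z"
      unfolding topspace_geometric_realization using unique by blast
    moreover have "u (realization_point X (n + m) (p, q) z) = y"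
      using pqz st by (simp add: u_point X)
    ultimately show ?thesis
      using pqz
      by (intro bexI[of _ "(p, q)"] bexI[of _ z]) (simp_all add: X)
  qed
  have u_in: "u v \<in> topspace ?Y" if "v \<in> topspace (geometric_realization X)" for v
    using u that by (auto simp: continuous_map_def)
  have point_in: "realization_point X k c t \<in> topspace (geometric_realization X)"
    if "c \<in> simplices X k" "t \<in> standard_simplex k" for k c t
    using continuous_map_realization_point[of c k] that by (auto simp: continuous_map_def)
  have "topspace (geometric_realization X)
      = (\<Union>c\<in>simplices X (n + m). realization_point X (n + m) c ` standard_simplex (n + m))"
  proof (intro equalityI subsetI)
    fix v assume "v \<in> topspace (geometric_realization X)"
    \<comment> \<open>With \<open>y = u v\<close>, uniqueness puts \<open>v\<close> itself in the
      image of an \<open>(n + m)\<close>-simplex.\<close>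
    with canonical[OF u_in, of v]
    show "v \<in> (\<Union>c\<in>simplices X (n + m). realization_point X (n + m) c ` standard_simplex (n + m))"
      by blast
  qed (use point_in in blast)
  moreover have "compactin (geometric_realization X)
      (\<Union>c\<in>simplices X (n + m). realization_point X (n + m) c ` standard_simplex (n + m))"
  proof (rule compactin_Union)
    show "finite ((\<lambda>c. realization_point X (n + m) c ` standard_simplex (n + m)) ` simplices X (n + m))"
      by (simp add: X finite_Delta_hom)
    fix S assume "S \<in> (\<lambda>c. realization_point X (n + m) c ` standard_simplex (n + m)) ` simplices X (n + m)"
    then show "compactin (geometric_realization X) S"
      using image_compactin[OF _ continuous_map_realization_point]
        compact_space_simplex_topology[of "n + m"]
      by (auto simp: compact_space_def)
  qed
  ultimately have "compact_space (geometric_realization X)"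
    by (simp add: compact_space_def)
  moreover have "Hausdorff_space ?Y"
    by (simp add: Hausdorff_space_prod_topology Hausdorff_space_simplex_topology)
  moreover have "u ` topspace (geometric_realization X) = topspace ?Y"
  proof (intro equalityI subsetI)
    fix y assume "y \<in> topspace ?Y"
    from canonical[OF this] point_in show "y \<in> u ` topspace (geometric_realization X)"
      by (metis imageI)
  qed (use u_in in blast)
  moreover have "inj_on u (topspace (geometric_realization X))"
  proof (rule inj_onI)
    fix v v'
    assume "v \<in> topspace (geometric_realization X)" "v' \<in> topspace (geometric_realization X)" "u v = u v'"
    with canonical[OF u_in, of v'] show "v = v'"
      by metis
  qed
  ultimately have "homeomorphic_map (geometric_realization X) ?Y u"
    using u by (intro continuous_imp_homeomorphic_map)
  then show ?thesis
    by (auto simp: X_def homeomorphic_map_imp_homeomorphic_space)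
qed

end
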